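(* Let $\mathcal{E}:L^2(X,m)\to[0,\infty]$ be a Dirichlet form such that $\mathcal{E}(0)=0$, and let $\mathfrak{D}$ be its Dirichlet space. Then $\mathfrak{D}$ is a Riesz subspace of $L^2(X,m)$; that is, for $u,v\in\mathfrak{D}$ we have $u\wedge v\in\mathfrak{D}$ and $u\vee v\in\mathfrak{D}$.
   Context: $X$ is a countably generated Borel space and $m$ a $\sigma$-finite Borel measure on $X$ with $\operatorname{supp}(m)=X$; $L^2(X,m)$ is the real $L^2$ space; $u\wedge v$ and $u\vee v$ denote the pointwise a.e. minimum and maximum; $w_+=w\vee 0$, $w_-=(-w)\vee 0$. A Dirichlet form is a convex, lower semicontinuous functional $\mathcal{E}:L^2(X,m)\to[0,\infty]$ with dense effective domain $\operatorname{dom}\mathcal{E}=\{u\mid\mathcal{E}(u)<\infty\}$ such that for all $u,v\in L^2(X,m)$ and $\alpha>0$: (1) $\mathcal{E}(u\wedge v)+\mathcal{E}(u\vee v)\le\mathcal{E}(u)+\mathcal{E}(v)$; (2) $\mathcal{E}(v+p)+\mathcal{E}(u-p)\le\mathcal{E}(u)+\mathcal{E}(v)$, where $p=\tfrac12\big((u-v+\alpha)_+-(u-v-\alpha)_-\big)$. Put $\mathcal{E}_1(u)=\|u\|_{L^2}^2+\mathcal{E}(u)$ and let the symmetric closure be $\operatorname{sym}\mathcal{E}(u)=\sup\{\mathcal{F}(u)\mid\mathcal{F}:L^2(X,m)\to(-\infty,\infty]\text{ lower semicontinuous and convex},\ \mathcal{F}(w)\le\mathcal{E}_1(w)\text{ and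 }\mathcal{F}(w)\le\mathcal{E}_1(-w)\text{ for all }w\in L^2(X,m)\}$. The Dirichlet space (energy space) of $\mathcal{E}$ is the linear space $\mathfrak{D}=\{f\in L^2(X,m)\mid\exists\,\lambda>0:\ \operatorname{sym}\mathcal{E}(\lambda f)<\infty\}$. *)

theory Defs
  imports "HOL-Analysis.Analysis"
begin

definition borel_measure_on :: "'a topology \<Rightarrow> 'a measure \<Rightarrow> bool" where
  "borel_measure_on X m \<longleftrightarrow>
     space m = topspace X \<and> sets m = sigma_sets (topspace X) {U. openin X U}"

definition countably_generated :: "'a measure \<Rightarrow> bool" where
  "countably_generated m \<longleftrightarrow>
     (\<exists>\<C>. countable \<C> \<and> \<C> \<subseteq> Pow (space m) \<and> sets m = sigma_sets (space m) \<C>)"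

definition measure_support :: "'a topology \<Rightarrow> 'a measure \<Rightarrow> 'a set" where
  "measure_support X m =
     {x \<in> topspace X. \<forall>U. openin X U \<and> x \<in> U \<longrightarrow> emeasure m U > 0}"

text \<open>
  The real space \<open>L\<^sup>2(X,m)\<close> is represented by its measurable square-integrable functions, without
  passing to the quotient by a.e. equality. Functionals on it are given by functions on
  representatives; their values outside \<^term>\<open>L2 m\<close> are irrelevant. Every functional
  below is lower semicontinuous for the \<open>L\<^sup>2\<close> seminorm and hence automatically constant on a.e.
  equivalence classes (lemma \<open>L2_lsc_AE_cong\<close>), so these are exactly the functionals on the quotient.
\<close>

definition L2 :: "'a measure \<Rightarrow> ('a \<Rightarrow> real) set" where
  "L2 m = {u \<in> borel_measurable m. integrable m (\<lambda>x. (u x)\<^sup>2)}"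

definition L2_norm :: "'a measure \<Rightarrow> ('a \<Rightarrow> real) \<Rightarrow> real" where
  "L2_norm m u = sqrt (\<integral>x. (u x)\<^sup>2 \<partial>m)"

definition L2_lsc :: "'a measure \<Rightarrow> (('a \<Rightarrow> real) \<Rightarrow> ereal) \<Rightarrow> bool" where
  "L2_lsc m F \<longleftrightarrow>
     (\<forall>u\<in>L2 m. \<forall>c. c < F u \<longrightarrow>
        (\<exists>\<delta>>0. \<forall>v\<in>L2 m. L2_norm m (\<lambda>x. v x - u x) < \<delta> \<longrightarrow> c < F v))"

definition L2_convex :: "'a measure \<Rightarrow> (('a \<Rightarrow> real) \<Rightarrow> ereal) \<Rightarrow> bool" where
  "L2_convex m F \<longleftrightarrow>
     (\<forall>u\<in>L2 m. \<forall>v\<in>L2 m. \<forall>t::real. 0 < t \<and> t < 1 \<longrightarrow>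
        F (\<lambda>x. t * u x + (1 - t) * v x) \<le> ereal t * F u + ereal (1 - t) * F v)"

definition L2_dense :: "'a measure \<Rightarrow> ('a \<Rightarrow> real) set \<Rightarrow> bool" where
  "L2_dense m S \<longleftrightarrow>
     (\<forall>u\<in>L2 m. \<forall>\<epsilon>>0. \<exists>v\<in>S. L2_norm m (\<lambda>x. v x - u x) < \<epsilon>)"

lemma L2_lsc_AE_cong:
  assumes F: "L2_lsc m F" and u: "u \<in> L2 m" and v: "v \<in> L2 m"
    and eq: "AE x in m. u x = v x"
  shows "F u = F v"
proof -
  have le: "F f \<le> F g" if "f \<in> L2 m" "g \<in> L2 m" "AE x in m. f x = g x" for f g
  proof (rule ccontr)
    assume "\<not> F f \<le> F g"
    then have "F g < F f" by simp
    with F that(1) obtain \<delta> where d: "\<delta> > 0"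
      "\<forall>v\<in>L2 m. L2_norm m (\<lambda>x. v x - f x) < \<delta> \<longrightarrow> F g < F v"
      unfolding L2_lsc_def by blast
    have "(\<integral>x. (g x - f x)\<^sup>2 \<partial>m) = 0"
      by (rule integral_eq_zero_AE) (use that(3) in auto)
    then have "L2_norm m (\<lambda>x. g x - f x) < \<delta>"
      using d(1) by (simp add: L2_norm_def)
    with d(2) that(2) show False by blast
  qed
  have "AE x in m. v x = u x" using eq by auto
  then show ?thesis using le[OF u v eq] le[OF v u] by (simp add: antisym)
qed

definition effective_domain ::
    "'a measure \<Rightarrow> (('a \<Rightarrow> real) \<Rightarrow> ereal) \<Rightarrow> ('a \<Rightarrow> real) set" where
  "effective_domain m E = {u \<in> L2 m. E u < \<infinity>}"

definition pos_part :: "real \<Rightarrow> real" where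
  "pos_part r = max r 0"

definition neg_part :: "real \<Rightarrow> real" where
  "neg_part r = max (- r) 0"

definition truncation :: "real \<Rightarrow> ('a \<Rightarrow> real) \<Rightarrow> ('a \<Rightarrow> real) \<Rightarrow> 'a \<Rightarrow> real" where
  "truncation \<alpha> u v x = (1/2) * (pos_part (u x - v x + \<alpha>) - neg_part (u x - v x - \<alpha>))"

definition dirichlet_form :: "'a measure \<Rightarrow> (('a \<Rightarrow> real) \<Rightarrow> ereal) \<Rightarrow> bool" where
  "dirichlet_form m E \<longleftrightarrow>
     (\<forall>u\<in>L2 m. 0 \<le> E u) \<and> L2_convex m E \<and> L2_lsc m E \<and> L2_dense m (effective_domain m E) \<and>
     (\<forall>u\<in>L2 m. \<forall>v\<in>L2 m.
        E (\<lambda>x. min (u x) (v x)) + E (\<lambda>x. max (u x) (v x)) \<le> E u + E v) \<and>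
     (\<forall>u\<in>L2 m. \<forall>v\<in>L2 m. \<forall>\<alpha>>0.
        E (\<lambda>x. v x + truncation \<alpha> u v x) + E (\<lambda>x. u x - truncation \<alpha> u v x) \<le> E u + E v)"

definition energy_one :: "'a measure \<Rightarrow> (('a \<Rightarrow> real) \<Rightarrow> ereal) \<Rightarrow> ('a \<Rightarrow> real) \<Rightarrow> ereal" where
  "energy_one m E u = ereal ((L2_norm m u)\<^sup>2) + E u"

definition sym_closure :: "'a measure \<Rightarrow> (('a \<Rightarrow> real) \<Rightarrow> ereal) \<Rightarrow> ('a \<Rightarrow> real) \<Rightarrow> ereal" where
  "sym_closure m E u =
     Sup {F u | F. (\<forall>w\<in>L2 m. - \<infinity> < F w) \<and> L2_lsc m F \<and> L2_convex m F \<and>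
        (\<forall>w\<in>L2 m. F w \<le> energy_one m E w \<and> F w \<le> energy_one m E (\<lambda>x. - w x))}"

definition dirichlet_space ::
    "'a measure \<Rightarrow> (('a \<Rightarrow> real) \<Rightarrow> ereal) \<Rightarrow> ('a \<Rightarrow> real) set" where
  "dirichlet_space m E = {f \<in> L2 m. \<exists>r>0. sym_closure m E (\<lambda>x. r * f x) < \<infinity>}"

definition L2_linear_subspace :: "'a measure \<Rightarrow> ('a \<Rightarrow> real) set \<Rightarrow> bool" where
  "L2_linear_subspace m D \<longleftrightarrow>
     D \<subseteq> L2 m \<and> (\<lambda>x. 0) \<in> D \<and>
     (\<forall>u\<in>D. \<forall>v\<in>D. (\<lambda>x. u x + v x) \<in> D) \<and>
     (\<forall>c. \<forall>u\<in>D. (\<lambda>x. c * u x) \<in> D)"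

definition L2_riesz_subspace :: "'a measure \<Rightarrow> ('a \<Rightarrow> real) set \<Rightarrow> bool" where
  "L2_riesz_subspace m D \<longleftrightarrow>
     L2_linear_subspace m D \<and>
     (\<forall>u\<in>D. \<forall>v\<in>D. (\<lambda>x. min (u x) (v x)) \<in> D \<and> (\<lambda>x. max (u x) (v x)) \<in> D)"

end

theory Submission
  imports Defs
begin

text \<open>
  The Dirichlet space consists exactly of the functions \<open>r (a - b)\<close> with \<open>r > 0\<close> and \<open>a\<close>, \<open>b\<close> in the
  effective domain. Such functions clearly have finite symmetric closure after scaling. Conversely,
  the lower semicontinuous relaxation of \<open>w \<mapsto> inf {\<E>\<^sub>1(a) + \<E>\<^sub>1(b) | a - b = w}\<close> competes in the
  supremum defining the symmetric closure, and where it is finite, strong convexity of \<open>\<E>\<^sub>1\<close> makes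
  almost-minimising pairs Cauchy, so that a minimising pair exists. The lattice property follows
  from \<open>(a - b)\<^sub>+ = a - a \<and> b\<close>, because the effective domain is closed under minima.
\<close>

section \<open>The seminormed space of square-integrable functions\<close>

lemma L2_measurable: "u \<in> L2 m \<Longrightarrow> u \<in> borel_measurable m"
  by (simp add: L2_def)

lemma L2_integrable_square: "u \<in> L2 m \<Longrightarrow> integrable m (\<lambda>x. (u x)\<^sup>2)"
  by (simp add: L2_def)

lemma L2_zero [simp]: "(\<lambda>x. 0) \<in> L2 m"
  by (simp add: L2_def)

lemma L2_scale: "u \<in> L2 m \<Longrightarrow> (\<lambda>x. c * u x) \<in> L2 m"
  by (auto simp: L2_def power_mult_distrib)

text \<open>Common source for sums, minima and maxima. The constant \<open>C\<close> leaves room for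
  the cross term of a sum, where \<open>C = 2\<close> is used.\<close>

lemma L2_dominated:
  assumes u: "u \<in> L2 m" and v: "v \<in> L2 m" and [measurable]: "w \<in> borel_measurable m"
    and le: "\<And>x. (w x)\<^sup>2 \<le> C * ((u x)\<^sup>2 + (v x)\<^sup>2)"
  shows "w \<in> L2 m"
proof -
  have "integrable m (\<lambda>x. C * ((u x)\<^sup>2 + (v x)\<^sup>2))"
    using u v by (auto simp: L2_def)
  then have "integrable m (\<lambda>x. (w x)\<^sup>2)"
  proof (rule Bochner_Integration.integrable_bound)
    show "AE x in m. norm ((w x)\<^sup>2) \<le> norm (C * ((u x)\<^sup>2 + (v x)\<^sup>2))"
      using order_trans[OF le abs_ge_self] by (intro AE_I2) (metis abs_power2 real_norm_def)
  qed measurable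
  then show ?thesis by (simp add: L2_def)
qed

lemma L2_add:
  assumes "u \<in> L2 m" "v \<in> L2 m"
  shows "(\<lambda>x. u x + v x) \<in> L2 m"
proof (rule L2_dominated[OF assms])
  show "(\<lambda>x. u x + v x) \<in> borel_measurable m"
    using assms[THEN L2_measurable] by measurable
  show "(u x + v x)\<^sup>2 \<le> 2 * ((u x)\<^sup>2 + (v x)\<^sup>2)" for x
    using zero_le_power2[of "u x - v x"] by (simp add: power2_eq_square algebra_simps)
qed

lemma L2_diff:
  assumes "u \<in> L2 m" "v \<in> L2 m"
  shows "(\<lambda>x. u x - v x) \<in> L2 m"
  using L2_add[OF assms(1) L2_scale[OF assms(2), of "-1"]] by simp

lemma L2_uminus: "u \<in> L2 m \<Longrightarrow> (\<lambda>x. - u x) \<in> L2 m"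
  using L2_scale[of u m "-1"] by simp

lemma L2_convex_combination:
  assumes "u \<in> L2 m" "v \<in> L2 m"
  shows "(\<lambda>x. s * u x + t * v x) \<in> L2 m"
  using assms by (intro L2_add L2_scale)

lemma L2_min:
  assumes "u \<in> L2 m" "v \<in> L2 m"
  shows "(\<lambda>x. min (u x) (v x)) \<in> L2 m"
proof (rule L2_dominated[OF assms])
  show "(\<lambda>x. min (u x) (v x)) \<in> borel_measurable m"
    using assms[THEN L2_measurable] by measurable
  show "(min (u x) (v x))\<^sup>2 \<le> 1 * ((u x)\<^sup>2 + (v x)\<^sup>2)" for x
    by (simp add: min_def)
qed

lemma L2_max:
  assumes "u \<in> L2 m" "v \<in> L2 m"
  shows "(\<lambda>x. max (u x) (v x)) \<in> L2 m"
proof (rule L2_dominated[OF assms])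
  show "(\<lambda>x. max (u x) (v x)) \<in> borel_measurable m"
    using assms[THEN L2_measurable] by measurable
  show "(max (u x) (v x))\<^sup>2 \<le> 1 * ((u x)\<^sup>2 + (v x)\<^sup>2)" for x
    by (simp add: max_def)
qed

section \<open>The seminorm: triangle inequality and the convexity identity\<close>

lemma L2_norm_nonneg [simp]: "0 \<le> L2_norm m u"
  by (simp add: L2_norm_def)

lemma L2_norm_power2: "(L2_norm m u)\<^sup>2 = (\<integral>x. (u x)\<^sup>2 \<partial>m)"
  by (simp add: L2_norm_def)

lemma L2_norm_zero [simp]: "L2_norm m (\<lambda>x. 0) = 0"
  by (simp add: L2_norm_def)

lemma L2_norm_scale: "L2_norm m (\<lambda>x. c * u x) = \<bar>c\<bar> * L2_norm m u"
  by (simp add: L2_norm_def power_mult_distrib real_sqrt_mult)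

lemma L2_norm_minus_commute: "L2_norm m (\<lambda>x. u x - v x) = L2_norm m (\<lambda>x. v x - u x)"
  by (simp add: L2_norm_def power2_commute)

lemma L2_norm_triangle:
  assumes u: "u \<in> L2 m" and v: "v \<in> L2 m"
  shows "L2_norm m (\<lambda>x. u x + v x) \<le> L2_norm m u + L2_norm m v"
proof (rule field_le_epsilon)
  fix e :: real assume e: "e > 0"
  \<comment> \<open>The added \<open>e/2\<close> keeps \<open>A\<close> and \<open>B\<close>
    positive, so that both can be denominators even when a seminorm vanishes.\<close>
  define A where "A = L2_norm m u + e/2"
  define B where "B = L2_norm m v + e/2"
  have A: "A > 0" and B: "B > 0"
    using e L2_norm_nonneg[of m u] L2_norm_nonneg[of m v] unfolding A_def B_def by linarith+
  have "(L2_norm m u)\<^sup>2 \<le> A\<^sup>2" "(L2_norm m v)\<^sup>2 \<le> B\<^sup>2"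
    using e by (simp_all add: A_def B_def power_mono)
  then have AB: "(L2_norm m u)\<^sup>2 / A \<le> A" "(L2_norm m v)\<^sup>2 / B \<le> B"
    using A B by (simp_all add: pos_divide_le_eq power2_eq_square)
  \<comment> \<open>Young's inequality with weights that become optimal as \<open>e\<close> tends to 0\<close>
  have young: "(p + q)\<^sup>2 \<le> (A + B) * (p\<^sup>2 / A + q\<^sup>2 / B)" for p q :: real
  proof -
    define y z where "y = p / A" and "z = q / B"
    then have pq: "p = A * y" "q = B * z" using A B by simp_all
    have eq: "p\<^sup>2 / A + q\<^sup>2 / B = A * y\<^sup>2 + B * z\<^sup>2"
      using A B unfolding pq by (simp add: power2_eq_square)
    have "(A + B) * (A * y\<^sup>2 + B * z\<^sup>2) - (p + q)\<^sup>2 = A * B * (y - z)\<^sup>2"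
      unfolding pq by (simp add: power2_eq_square algebra_simps)
    moreover have "A * B * (y - z)\<^sup>2 \<ge> 0" using A B by simp
    ultimately show ?thesis unfolding eq by linarith
  qed
  note [simp] = L2_integrable_square[OF u] L2_integrable_square[OF v]
  have "(L2_norm m (\<lambda>x. u x + v x))\<^sup>2 \<le> (\<integral>x. (A + B) * ((u x)\<^sup>2 / A + (v x)\<^sup>2 / B) \<partial>m)"
    unfolding L2_norm_power2
    by (intro integral_mono young L2_integrable_square L2_add u v) simp
  also have "\<dots> = (A + B) * ((L2_norm m u)\<^sup>2 / A + (L2_norm m v)\<^sup>2 / B)"
    by (simp add: L2_norm_power2)
  also have "\<dots> \<le> (A + B) * (A + B)"
    using A B AB by (intro mult_left_mono add_mono) simp_all
  also have "\<dots> = (A + B)\<^sup>2" by (rule power2_eq_square[symmetric])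
  finally have "L2_norm m (\<lambda>x. u x + v x) \<le> A + B"
    by (rule power2_le_imp_le) (use A B in linarith)
  then show "L2_norm m (\<lambda>x. u x + v x) \<le> L2_norm m u + L2_norm m v + e"
    by (simp add: A_def B_def)
qed

lemma L2_norm_triangle3:
  assumes "u \<in> L2 m" "v \<in> L2 m" "w \<in> L2 m"
  shows "L2_norm m (\<lambda>x. u x - w x) \<le> L2_norm m (\<lambda>x. u x - v x) + L2_norm m (\<lambda>x. v x - w x)"
  using L2_norm_triangle[OF L2_diff[OF assms(1,2)] L2_diff[OF assms(2,3)]] by simp

text \<open>An exact form of the convexity of the squared norm. Its quadratic term is what makes
  \<open>energy_one\<close> strongly convex and later forces minimising sequences to be
  Cauchy.\<close>

lemma L2_norm_convex_combination:
  assumes u: "u \<in> L2 m" and v: "v \<in> L2 m"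
  shows "(L2_norm m (\<lambda>x. t * u x + (1 - t) * v x))\<^sup>2 + t * (1 - t) * (L2_norm m (\<lambda>x. u x - v x))\<^sup>2
    = t * (L2_norm m u)\<^sup>2 + (1 - t) * (L2_norm m v)\<^sup>2"
proof -
  note int [simp] = L2_integrable_square[OF u] L2_integrable_square[OF v]
    L2_integrable_square[OF L2_convex_combination[OF u v]] L2_integrable_square[OF L2_diff[OF u v]]
  have "(L2_norm m (\<lambda>x. t * u x + (1 - t) * v x))\<^sup>2 + t * (1 - t) * (L2_norm m (\<lambda>x. u x - v x))\<^sup>2
    = (\<integral>x. (t * u x + (1 - t) * v x)\<^sup>2 + t * (1 - t) * (u x - v x)\<^sup>2 \<partial>m)"
    by (simp add: L2_norm_power2)
  also have "\<dots> = (\<integral>x. t * (u x)\<^sup>2 + (1 - t) * (v x)\<^sup>2 \<partial>m)"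
    by (intro Bochner_Integration.integral_cong refl) (simp add: power2_eq_square algebra_simps)
  also have "\<dots> = t * (L2_norm m u)\<^sup>2 + (1 - t) * (L2_norm m v)\<^sup>2"
    by (simp add: L2_norm_power2)
  finally show ?thesis .
qed

lemma L2_norm_eq_zero_AE:
  assumes "u \<in> L2 m" "L2_norm m u = 0"
  shows "AE x in m. u x = 0"
  using integral_nonneg_eq_0_iff_AE[OF L2_integrable_square[OF assms(1)]] assms(2)
  by (simp add: L2_norm_def)

section \<open>Completeness, with limits built pointwise almost everywhere\<close>

lemma nn_integral_square_L2_norm:
  assumes "u \<in> L2 m"
  shows "(\<integral>\<^sup>+x. ennreal ((u x)\<^sup>2) \<partial>m) = ennreal ((L2_norm m u)\<^sup>2)"
  unfolding L2_norm_power2 by (rule nn_integral_eq_integral) (use assms in \<open>auto simp: L2_def\<close>)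

text \<open>The squared increments, weighted by \<open>2^n\<close>, have integrals at most
  \<open>(1/2)^n\<close>. Their sum is therefore finite almost everywhere, which makes the
  increments absolutely summable there. Squares are used because the measure may be infinite, so
  bounds in the seminorm do not give integrability of the increments.\<close>

lemma L2_fast_Cauchy_convergent_AE:
  fixes g :: "nat \<Rightarrow> 'a \<Rightarrow> real"
  assumes g: "\<And>n. g n \<in> L2 m"
    and fast: "\<And>n. L2_norm m (\<lambda>x. g (Suc n) x - g n x) \<le> (1/2)^n"
  shows "AE x in m. convergent (\<lambda>n. g n x)"
proof -
  define d where "d n x = g (Suc n) x - g n x" for n x
  have d: "d n \<in> L2 m" for n unfolding d_def by (intro L2_diff g)
  have [measurable]: "d n \<in> borel_measurable m" for n by (rule L2_measurable[OF d])
  have "(\<integral>\<^sup>+x. (\<Sum>n. ennreal (2^n * (d n x)\<^sup>2)) \<partial>m) = (\<Sum>n. \<integral>\<^sup>+x. ennreal (2^n * (d n x)\<^sup>2) \<partial>m)"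
    by (rule nn_integral_suminf) measurable
  also have "\<dots> \<le> (\<Sum>n. ennreal ((1/2)^n))"
  proof (intro suminf_le allI)
    fix n
    have "(\<integral>\<^sup>+x. ennreal (2^n * (d n x)\<^sup>2) \<partial>m) = ennreal (2^n) * ennreal ((L2_norm m (d n))\<^sup>2)"
      unfolding nn_integral_square_L2_norm[OF d, symmetric]
      by (subst nn_integral_cmult[symmetric]) (auto simp: ennreal_mult)
    also have "\<dots> = ennreal (2^n * (L2_norm m (d n))\<^sup>2)" by (simp add: ennreal_mult)
    also have "\<dots> \<le> ennreal (2^n * ((1/2)^n)\<^sup>2)"
      using fast[of n] unfolding d_def
      by (intro ennreal_leI mult_left_mono power_mono) auto
    also have "2^n * ((1/2)^n)\<^sup>2 = (1/2::real)^n"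
      by (simp add: power2_eq_square power_divide)
    finally show "(\<integral>\<^sup>+x. ennreal (2^n * (d n x)\<^sup>2) \<partial>m) \<le> ennreal ((1/2)^n)" .
  qed auto
  also have "\<dots> < \<infinity>"
    by (subst suminf_ennreal2) (auto simp: summable_geometric)
  finally have "(\<integral>\<^sup>+x. (\<Sum>n. ennreal (2^n * (d n x)\<^sup>2)) \<partial>m) \<noteq> \<infinity>" by simp
  then have "AE x in m. (\<Sum>n. ennreal (2^n * (d n x)\<^sup>2)) \<noteq> \<infinity>"
    by (intro nn_integral_PInf_AE) measurable
  then show ?thesis
  proof eventually_elim
    case (elim x)
    have sm: "summable (\<lambda>n. 2^n * (d n x)\<^sup>2)"
      by (rule summable_suminf_not_top) (use elim in auto)
    \<comment> \<open>AM-GM: \<open>2 \<bar>d\<^sub>n\<bar> \<le> 2^n d\<^sub>n\<^sup>2 + (1/2)^n\<close>\<close>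
    have "summable (\<lambda>n. 2^n * (d n x)\<^sup>2 + (1/2)^n)"
      by (intro summable_add sm summable_geometric) simp
    then have "summable (\<lambda>n. d n x)"
    proof (rule summable_comparison_test'[where N = 0])
      fix n :: nat
      define s :: real where "s = 2^n"
      have s: "s > 0" by (simp add: s_def)
      have "0 \<le> (s * \<bar>d n x\<bar> - 1)\<^sup>2 / s" using s by simp
      also have "\<dots> = s * (d n x)\<^sup>2 + 1/s - 2 * \<bar>d n x\<bar>"
        using s by (simp add: field_simps power2_eq_square)
      finally show "norm (d n x) \<le> 2^n * (d n x)\<^sup>2 + (1/2)^n"
        by (simp add: s_def power_divide)
    qed
    then have "convergent (\<lambda>n. \<Sum>k<n. d k x)" by (simp add: summable_iff_convergent)
    moreover have "(\<Sum>k<n. d k x) = g n x - g 0 x" for n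
      unfolding d_def by (rule sum_lessThan_telescope)
    ultimately have "convergent (\<lambda>n. g n x - g 0 x)" by simp
    then have "convergent (\<lambda>n. (g n x - g 0 x) + g 0 x)"
      by (rule convergent_add) (rule convergent_const)
    then show ?case by simp
  qed
qed

text \<open>Fatou's lemma for the squares of \<open>g k - u\<close>. With \<open>u\<close> a member
  of a Cauchy sequence, it yields both that the limit is square-integrable and how far it is from
  that member.\<close>

lemma L2_AE_limit:
  fixes g :: "nat \<Rightarrow> 'a \<Rightarrow> real"
  assumes g: "\<And>k. g k \<in> L2 m" and h: "h \<in> borel_measurable m"
    and lim: "AE x in m. (\<lambda>k. g k x) \<longlonglongrightarrow> h x"
    and u: "u \<in> L2 m" and bound: "eventually (\<lambda>k. L2_norm m (\<lambda>x. g k x - u x) \<le> c) sequentially"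
  shows "h \<in> L2 m" and "L2_norm m (\<lambda>x. h x - u x) \<le> c"
proof -
  note [measurable] = L2_measurable[OF g] L2_measurable[OF u] h
  \<comment> \<open>One index satisfying the bound already shows that \<open>c\<close> is
    nonnegative, which the final passage from squares to norms requires.\<close>
  obtain k where "L2_norm m (\<lambda>x. g k x - u x) \<le> c"
    using eventually_happens[OF bound] by auto
  then have c: "c \<ge> 0" by (rule order_trans[OF L2_norm_nonneg])
  have "(\<integral>\<^sup>+x. ennreal ((h x - u x)\<^sup>2) \<partial>m) = (\<integral>\<^sup>+x. liminf (\<lambda>k. ennreal ((g k x - u x)\<^sup>2)) \<partial>m)"
  proof (rule nn_integral_cong_AE, use lim in eventually_elim)
    case (elim x)
    have "(\<lambda>k. ennreal ((g k x - u x)\<^sup>2)) \<longlonglongrightarrow> ennreal ((h x - u x)\<^sup>2)"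
      by (intro tendsto_intros elim)
    from lim_imp_Liminf[OF sequentially_bot this] show ?case by (rule sym)
  qed
  also have "\<dots> \<le> liminf (\<lambda>k. \<integral>\<^sup>+x. ennreal ((g k x - u x)\<^sup>2) \<partial>m)"
    by (rule nn_integral_liminf) measurable
  also have "\<dots> = liminf (\<lambda>k. ennreal ((L2_norm m (\<lambda>x. g k x - u x))\<^sup>2))"
    by (simp add: nn_integral_square_L2_norm L2_diff g u)
  also have "\<dots> \<le> ennreal (c\<^sup>2)"
  proof -
    have "eventually (\<lambda>k. ennreal ((L2_norm m (\<lambda>x. g k x - u x))\<^sup>2) \<le> ennreal (c\<^sup>2)) sequentially"
      using bound by eventually_elim (auto intro!: ennreal_leI power_mono)
    then have "liminf (\<lambda>k. ennreal ((L2_norm m (\<lambda>x. g k x - u x))\<^sup>2)) \<le> liminf (\<lambda>k. ennreal (c\<^sup>2))"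
      by (rule Liminf_mono)
    then show ?thesis by (simp add: Liminf_const)
  qed
  finally have le: "(\<integral>\<^sup>+x. ennreal ((h x - u x)\<^sup>2) \<partial>m) \<le> ennreal (c\<^sup>2)" .
  then have "integrable m (\<lambda>x. (h x - u x)\<^sup>2)"
    by (intro integrableI_nonneg) (auto intro: le_less_trans)
  then have hu: "(\<lambda>x. h x - u x) \<in> L2 m" by (simp add: L2_def)
  then show "h \<in> L2 m" using L2_add[OF hu u] by simp
  have "(L2_norm m (\<lambda>x. h x - u x))\<^sup>2 \<le> c\<^sup>2"
    using le nn_integral_square_L2_norm[OF hu] by simp
  then show "L2_norm m (\<lambda>x. h x - u x) \<le> c" using c by (rule power2_le_imp_le)
qed

text \<open>The Riesz-Fischer argument: a fast subsequence converges almost everywhere, and Fatou's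
  lemma bounds the distance from its limit to the late members of the whole sequence.\<close>

lemma L2_complete:
  fixes f :: "nat \<Rightarrow> 'a \<Rightarrow> real"
  assumes f: "\<And>n. f n \<in> L2 m"
    and Cauchy: "\<And>e. e > 0 \<Longrightarrow> \<exists>N. \<forall>i\<ge>N. \<forall>j\<ge>N. L2_norm m (\<lambda>x. f i x - f j x) < e"
  obtains h where "h \<in> L2 m" "(\<lambda>n. L2_norm m (\<lambda>x. h x - f n x)) \<longlonglongrightarrow> 0"
proof -
  have "\<exists>N. \<forall>i\<ge>N. \<forall>j\<ge>N. L2_norm m (\<lambda>x. f i x - f j x) < (1/2)^n" for n :: nat
    by (rule Cauchy) simp
  then obtain M where M: "\<And>n i j. i \<ge> M n \<Longrightarrow> j \<ge> M n \<Longrightarrow> L2_norm m (\<lambda>x. f i x - f j x) < (1/2)^n"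
    by metis
  \<comment> \<open>Summing the thresholds gives indices that dominate \<open>M n\<close> and never
    decrease; the extra \<open>n\<close> makes them tend to infinity.\<close>
  define r where "r n = (\<Sum>k\<le>n. M k) + n" for n
  have rM: "r n \<ge> M n" for n
    using member_le_sum[of n "{..n}" M] by (simp add: r_def)
  have rn: "r n \<ge> n" and rS: "r (Suc n) \<ge> r n" for n
    by (simp_all add: r_def)
  have fast: "L2_norm m (\<lambda>x. f (r (Suc n)) x - f (r n) x) \<le> (1/2)^n" for n
    using M[of n "r (Suc n)" "r n"] rM[of n] rS[of n] by simp
  \<comment> \<open>Where the subsequence diverges, \<open>lim\<close> has an unspecified value;
    this concerns only a null set, and \<open>h\<close> is still measurable.\<close>
  define h where "h x = lim (\<lambda>n. f (r n) x)" for x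
  note [measurable] = L2_measurable[OF f]
  have h [measurable]: "h \<in> borel_measurable m" unfolding h_def by measurable
  have lim: "AE x in m. (\<lambda>n. f (r n) x) \<longlonglongrightarrow> h x"
    using L2_fast_Cauchy_convergent_AE[of "\<lambda>n. f (r n)", OF f fast]
    unfolding h_def convergent_LIMSEQ_iff .
  note limit = L2_AE_limit[of "\<lambda>n. f (r n)", OF f h lim f]
  have ev: "\<exists>N. \<forall>i\<ge>N. eventually (\<lambda>k. L2_norm m (\<lambda>x. f (r k) x - f i x) \<le> e) sequentially"
    if e: "e > 0" for e
  proof -
    obtain N where N: "\<And>i j. i \<ge> N \<Longrightarrow> j \<ge> N \<Longrightarrow> L2_norm m (\<lambda>x. f i x - f j x) < e"
      using Cauchy[OF e] by blast
    have "eventually (\<lambda>k. L2_norm m (\<lambda>x. f (r k) x - f i x) \<le> e) sequentially" if "i \<ge> N" for i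
      using eventually_ge_at_top[of N]
      by eventually_elim (rule less_imp_le[OF N[OF le_trans[OF _ rn] that]])
    then show ?thesis by blast
  qed
  have "h \<in> L2 m" using ev[OF zero_less_one] limit(1) by auto
  moreover have "(\<lambda>n. L2_norm m (\<lambda>x. h x - f n x)) \<longlonglongrightarrow> 0"
  proof (rule LIMSEQ_I)
    fix e :: real assume "e > 0"
    then obtain N where N: "\<And>i. i \<ge> N \<Longrightarrow>
        eventually (\<lambda>k. L2_norm m (\<lambda>x. f (r k) x - f i x) \<le> e/2) sequentially"
      using ev[OF half_gt_zero] by blast
    \<comment> \<open>Only weak inequalities survive the limit, hence \<open>e/2\<close> in order to
      end strictly below \<open>e\<close>.\<close>
    have "L2_norm m (\<lambda>x. h x - f i x) \<le> e/2" if "i \<ge> N" for i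
      by (rule limit(2)[OF N[OF that]])
    then show "\<exists>N. \<forall>i\<ge>N. norm (L2_norm m (\<lambda>x. h x - f i x) - 0) < e"
      using \<open>e > 0\<close> by (intro exI[of _ N]) fastforce
  qed
  ultimately show ?thesis by (rule that)
qed

text \<open>The form in which minimising sequences supply their estimate: squared distances,
  controlled by the smaller index alone.\<close>

lemma L2_complete_power2:
  fixes f :: "nat \<Rightarrow> 'a \<Rightarrow> real"
  assumes f: "\<And>n. f n \<in> L2 m" and \<delta>: "\<delta> \<longlonglongrightarrow> 0"
    and le: "\<And>n k. n \<le> k \<Longrightarrow> (L2_norm m (\<lambda>x. f n x - f k x))\<^sup>2 \<le> \<delta> n"
  obtains h where "h \<in> L2 m" "(\<lambda>n. L2_norm m (\<lambda>x. h x - f n x)) \<longlonglongrightarrow> 0"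
proof (rule L2_complete[OF f])
  fix e :: real assume e: "e > 0"
  then have "eventually (\<lambda>n. \<delta> n < e\<^sup>2) sequentially"
    by (intro order_tendstoD(2)[OF \<delta>]) simp
  then obtain N where N: "\<And>n. n \<ge> N \<Longrightarrow> \<delta> n < e\<^sup>2"
    by (auto simp: eventually_sequentially)
  have less: "L2_norm m (\<lambda>x. f i x - f j x) < e" if "N \<le> i" "i \<le> j" for i j
    using le_less_trans[OF le[OF that(2)] N[OF that(1)]] e by (auto intro: power2_less_imp_less)
  have "L2_norm m (\<lambda>x. f i x - f j x) < e" if "N \<le> i" "N \<le> j" for i j
    using less[of i j] less[of j i] that L2_norm_minus_commute[of m "f i" "f j"]
    by (cases "i \<le> j") simp_all
  then show "\<exists>N. \<forall>i\<ge>N. \<forall>j\<ge>N. L2_norm m (\<lambda>x. f i x - f j x) < e" by blast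
qed (rule that)

section \<open>Attained difference representations\<close>

text \<open>Sublevel sets are sequentially closed; this carries energy bounds over to the limits of
  minimising sequences.\<close>

lemma L2_lsc_limit_le:
  assumes F: "L2_lsc m F" and h: "h \<in> L2 m" and f: "\<And>n. f n \<in> L2 m"
    and lim: "(\<lambda>n. L2_norm m (\<lambda>x. h x - f n x)) \<longlonglongrightarrow> 0" and le: "\<And>n. F (f n) \<le> c"
  shows "F h \<le> c"
proof (rule ccontr)
  assume "\<not> F h \<le> c"
  then have "c < F h" by simp
  then obtain d where d: "d > 0" "\<And>v. v \<in> L2 m \<Longrightarrow> L2_norm m (\<lambda>x. v x - h x) < d \<Longrightarrow> c < F v"
    using F h unfolding L2_lsc_def by blast
  obtain n where "L2_norm m (\<lambda>x. h x - f n x) < d"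
    using eventually_happens[OF order_tendstoD(2)[OF lim d(1)]] by auto
  then have "c < F (f n)" by (intro d(2) f) (simp add: L2_norm_minus_commute)
  with le[of n] show False by simp
qed

text \<open>Collects the properties that identify the Dirichlet space. The lattice inequality enters
  later, through the premise \<open>dom_min\<close>.\<close>

locale L2_energy =
  fixes m :: "'a measure" and E :: "('a \<Rightarrow> real) \<Rightarrow> ereal"
  assumes nonneg: "u \<in> L2 m \<Longrightarrow> 0 \<le> E u"
    and convex: "L2_convex m E"
    and lsc: "L2_lsc m E"
    and zero: "E (\<lambda>x. 0) = 0"
begin

section \<open>Convexity of the effective domain and strong convexity of
  \<open>energy_one\<close>\<close>

lemma effective_domain_convex:
  assumes "a \<in> effective_domain m E" "b \<in> effective_domain m E" "0 < t" "t < 1"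
  shows "(\<lambda>x. t * a x + (1 - t) * b x) \<in> effective_domain m E"
proof -
  have "E (\<lambda>x. t * a x + (1 - t) * b x) \<le> ereal t * E a + ereal (1 - t) * E b"
    using assms convex unfolding L2_convex_def effective_domain_def by blast
  also have "\<dots> < \<infinity>"
    using assms nonneg[of a] nonneg[of b] unfolding effective_domain_def
    by (cases "E a"; cases "E b") auto
  finally show ?thesis
    using assms by (auto simp: effective_domain_def intro: L2_convex_combination)
qed

lemma zero_effective_domain: "(\<lambda>x. 0) \<in> effective_domain m E"
  by (simp add: effective_domain_def zero)

lemma energy_one_nonneg: "u \<in> L2 m \<Longrightarrow> 0 \<le> energy_one m E u"
  using nonneg[of u] by (simp add: energy_one_def)

lemma energy_one_zero: "energy_one m E (\<lambda>x. 0) = 0"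
  by (simp add: energy_one_def zero)

lemma energy_le_energy_one: "E u \<le> energy_one m E u"
  by (simp add: energy_one_def ereal_le_add_self2)

lemma energy_one_finite: "a \<in> effective_domain m E \<Longrightarrow> energy_one m E a < \<infinity>"
  by (simp add: energy_one_def effective_domain_def)

text \<open>The quadratic gain comes entirely from the squared norm, by
  \<open>L2_norm_convex_combination\<close>; \<open>E\<close> contributes plain convexity.\<close>

lemma energy_one_strongly_convex:
  assumes u: "u \<in> L2 m" and v: "v \<in> L2 m" and t: "0 < t" "t < 1"
  shows "energy_one m E (\<lambda>x. t * u x + (1 - t) * v x)
      + ereal (t * (1 - t) * (L2_norm m (\<lambda>x. u x - v x))\<^sup>2)
    \<le> ereal t * energy_one m E u + ereal (1 - t) * energy_one m E v"
proof (cases "E u = \<infinity> \<or> E v = \<infinity>")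
  case True
  then have "ereal t * energy_one m E u + ereal (1 - t) * energy_one m E v = \<infinity>"
    using t nonneg[OF u] nonneg[OF v] unfolding energy_one_def
    by (cases "E u"; cases "E v") auto
  then show ?thesis by (simp only: ereal_less_eq)
next
  case False
  then obtain p q where p: "E u = ereal p" and q: "E v = ereal q"
    using nonneg[OF u] nonneg[OF v] by (cases "E u"; cases "E v") auto
  define w where "w = (\<lambda>x. t * u x + (1 - t) * v x)"
  have "E w \<le> ereal t * E u + ereal (1 - t) * E v"
    using convex u v t unfolding L2_convex_def w_def by blast
  then have Ew: "E w \<le> ereal (t * p + (1 - t) * q)" by (simp add: p q)
  moreover have "0 \<le> E w" unfolding w_def by (intro nonneg L2_convex_combination u v)
  ultimately obtain s where s: "E w = ereal s" "s \<le> t * p + (1 - t) * q"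
    by (cases "E w") auto
  have "(L2_norm m w)\<^sup>2 + s + t * (1 - t) * (L2_norm m (\<lambda>x. u x - v x))\<^sup>2
    \<le> t * ((L2_norm m u)\<^sup>2 + p) + (1 - t) * ((L2_norm m v)\<^sup>2 + q)"
    using L2_norm_convex_combination[OF u v, of t] s(2) unfolding w_def[symmetric]
    by (simp only: distrib_left)
  then show ?thesis unfolding w_def[symmetric] by (simp add: energy_one_def p q s(1))
qed

section \<open>Approximate difference representations and their relaxed energy\<close>

definition near_differences :: "real \<Rightarrow> ('a \<Rightarrow> real) \<Rightarrow> (('a \<Rightarrow> real) \<times> ('a \<Rightarrow> real)) set" where
  "near_differences e w =
     {(a, b). a \<in> L2 m \<and> b \<in> L2 m \<and> L2_norm m (\<lambda>x. a x - b x - w x) < e}"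

text \<open>For square-integrable \<open>w\<close> this is the infimum, over the open ball of radius
  \<open>e\<close> around \<open>w\<close>, of the least energy of an exact representation
  \<open>a - b\<close>. The supremum over \<open>e\<close> in \<open>difference_relaxation\<close>
  is therefore the lower semicontinuous envelope of that least energy.\<close>

definition difference_energy :: "real \<Rightarrow> ('a \<Rightarrow> real) \<Rightarrow> ereal" where
  "difference_energy e w =
     (INF (a, b)\<in>near_differences e w. energy_one m E a + energy_one m E b)"

definition difference_relaxation :: "('a \<Rightarrow> real) \<Rightarrow> ereal" where
  "difference_relaxation w = (SUP e\<in>{0<..}. difference_energy e w)"

lemma difference_energy_le:
  "(a, b) \<in> near_differences e w \<Longrightarrow> difference_energy e w \<le> energy_one m E a + energy_one m E b"
  unfolding difference_energy_def by (rule INF_lower2[of "(a, b)"]) auto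

lemma difference_energy_lessE:
  assumes "difference_energy e w < c"
  obtains a b where "(a, b) \<in> near_differences e w" "energy_one m E a + energy_one m E b < c"
  using assms unfolding difference_energy_def INF_less_iff by auto

lemma difference_energy_nonneg: "0 \<le> difference_energy e w"
  unfolding difference_energy_def
  by (rule INF_greatest) (auto simp: near_differences_def intro!: add_nonneg_nonneg energy_one_nonneg)

lemma difference_energy_le_relaxation:
  "0 < e \<Longrightarrow> difference_energy e w \<le> difference_relaxation w"
  unfolding difference_relaxation_def by (rule SUP_upper) simp

lemma difference_energy_mono:
  assumes "near_differences d w \<subseteq> near_differences e v"
  shows "difference_energy e v \<le> difference_energy d w"
  unfolding difference_energy_def by (rule INF_superset_mono[OF assms]) simp

lemma near_differences_mono: "d \<le> e \<Longrightarrow> near_differences d w \<subseteq> near_differences e w"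
  by (auto simp: near_differences_def)

text \<open>By the triangle inequality, a ball around \<open>v\<close> lies in a larger ball around
  a nearby \<open>w\<close>. Lower semicontinuity of the relaxation rests on this.\<close>

lemma near_differences_shift:
  assumes w: "w \<in> L2 m" and v: "v \<in> L2 m" and "L2_norm m (\<lambda>x. v x - w x) < d"
  shows "near_differences e v \<subseteq> near_differences (e + d) w"
proof (clarsimp simp: near_differences_def)
  fix a b assume a: "a \<in> L2 m" and b: "b \<in> L2 m" and "L2_norm m (\<lambda>x. a x - b x - v x) < e"
  with assms L2_norm_triangle3[OF L2_diff[OF a b] v w]
  show "L2_norm m (\<lambda>x. a x - b x - w x) < e + d" by simp
qed

text \<open>The error of the averaged pair is the average of the errors, so the tolerance
  \<open>e\<close> does not grow.\<close>

lemma near_differences_convex: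
  assumes ab: "(a, b) \<in> near_differences e u" and cd: "(c, d) \<in> near_differences e v"
    and u: "u \<in> L2 m" and v: "v \<in> L2 m" and t: "0 < t" "t < 1"
  shows "(\<lambda>x. t * a x + (1 - t) * c x, \<lambda>x. t * b x + (1 - t) * d x)
    \<in> near_differences e (\<lambda>x. t * u x + (1 - t) * v x)"
proof -
  have L2: "a \<in> L2 m" "b \<in> L2 m" "c \<in> L2 m" "d \<in> L2 m"
    and less: "L2_norm m (\<lambda>x. a x - b x - u x) < e" "L2_norm m (\<lambda>x. c x - d x - v x) < e"
    using ab cd by (auto simp: near_differences_def)
  have eq: "(\<lambda>x. t * a x + (1 - t) * c x - (t * b x + (1 - t) * d x) - (t * u x + (1 - t) * v x))
    = (\<lambda>x. t * (a x - b x - u x) + (1 - t) * (c x - d x - v x))"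
    by (simp add: algebra_simps)
  have "L2_norm m (\<lambda>x. t * (a x - b x - u x) + (1 - t) * (c x - d x - v x))
    \<le> t * L2_norm m (\<lambda>x. a x - b x - u x) + (1 - t) * L2_norm m (\<lambda>x. c x - d x - v x)"
    using L2_norm_triangle[of "\<lambda>x. t * (a x - b x - u x)" m "\<lambda>x. (1 - t) * (c x - d x - v x)"] t
    by (simp add: L2_norm_scale L2_scale L2_diff L2 u v)
  also have "\<dots> < t * e + (1 - t) * e"
    using less t by (intro add_strict_mono mult_strict_left_mono) auto
  finally show ?thesis
    using L2 unfolding near_differences_def
    by (simp add: L2_convex_combination eq) (simp add: algebra_simps)
qed

text \<open>The averaged pair competes in the infimum, and strong convexity applies to each
  component. Dropping the quadratic term gives convexity of the relaxation; taking
  \<open>u = v\<close> and \<open>t = 1/2\<close> bounds the distance between almost-minimising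
  pairs.\<close>

lemma difference_energy_strongly_convex:
  assumes ab: "(a, b) \<in> near_differences e u" and cd: "(c, d) \<in> near_differences e v"
    and u: "u \<in> L2 m" and v: "v \<in> L2 m" and t: "0 < t" "t < 1"
  shows "difference_energy e (\<lambda>x. t * u x + (1 - t) * v x)
      + ereal (t * (1 - t) * ((L2_norm m (\<lambda>x. a x - c x))\<^sup>2 + (L2_norm m (\<lambda>x. b x - d x))\<^sup>2))
    \<le> ereal t * (energy_one m E a + energy_one m E b)
      + ereal (1 - t) * (energy_one m E c + energy_one m E d)"
proof -
  have L2: "a \<in> L2 m" "b \<in> L2 m" "c \<in> L2 m" "d \<in> L2 m"
    using ab cd by (auto simp: near_differences_def)
  note nn = L2[THEN energy_one_nonneg]
  let ?p = "t * (1 - t) * (L2_norm m (\<lambda>x. a x - c x))\<^sup>2"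
  let ?q = "t * (1 - t) * (L2_norm m (\<lambda>x. b x - d x))\<^sup>2"
  let ?A = "energy_one m E (\<lambda>x. t * a x + (1 - t) * c x)"
  let ?B = "energy_one m E (\<lambda>x. t * b x + (1 - t) * d x)"
  have "difference_energy e (\<lambda>x. t * u x + (1 - t) * v x) + ereal (?p + ?q)
    \<le> (?A + ?B) + (ereal ?p + ereal ?q)"
    using difference_energy_le[OF near_differences_convex[OF assms]]
    by (intro add_mono) auto
  also have "\<dots> = (?A + ereal ?p) + (?B + ereal ?q)"
    by (simp only: ac_simps)
  also have "\<dots> \<le> (ereal t * energy_one m E a + ereal (1 - t) * energy_one m E c)
      + (ereal t * energy_one m E b + ereal (1 - t) * energy_one m E d)"
    by (intro add_mono[OF energy_one_strongly_convex energy_one_strongly_convex] L2 t)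
  also have "\<dots> = ereal t * (energy_one m E a + energy_one m E b)
      + ereal (1 - t) * (energy_one m E c + energy_one m E d)"
    using nn by (simp add: ereal_right_distrib ac_simps)
  finally show ?thesis by (simp only: distrib_left)
qed

lemma difference_relaxation_convex: "L2_convex m difference_relaxation"
  unfolding L2_convex_def
proof (intro ballI allI impI)
  fix u v :: "'a \<Rightarrow> real" and t :: real
  assume u: "u \<in> L2 m" and v: "v \<in> L2 m" and "0 < t \<and> t < 1"
  then have t: "0 < t" "t < 1" by auto
  let ?w = "\<lambda>x. t * u x + (1 - t) * v x"
  have "difference_energy e ?w \<le> ereal t * difference_relaxation u + ereal (1 - t) * difference_relaxation v"
    if e: "e > 0" for e
  proof -
    have "difference_energy e ?w \<le> ereal t * difference_energy e u + ereal (1 - t) * difference_energy e v"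
    proof (cases "difference_energy e u = \<infinity> \<or> difference_energy e v = \<infinity>")
      case True
      then have "ereal t * difference_energy e u + ereal (1 - t) * difference_energy e v = \<infinity>"
        using t difference_energy_nonneg[of e u] difference_energy_nonneg[of e v]
        by (cases "difference_energy e u"; cases "difference_energy e v") auto
      then show ?thesis by (simp only: ereal_less_eq)
    next
      case False
      then obtain p q where p: "difference_energy e u = ereal p" and q: "difference_energy e v = ereal q"
        using difference_energy_nonneg[of e u] difference_energy_nonneg[of e v]
        by (cases "difference_energy e u"; cases "difference_energy e v") auto
      show ?thesis
      proof (rule ereal_le_epsilon2)
        \<comment> \<open>Both pairs are chosen optimal up to \<open>r\<close>. As the weights add
          up to 1, the total excess is again \<open>r\<close>.\<close>
        fix r :: real assume r: "0 < r"
        obtain a b where ab: "(a, b) \<in> near_differences e u"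
          "energy_one m E a + energy_one m E b < ereal (p + r)"
          using difference_energy_lessE[of e u "ereal (p + r)"] r p by auto
        obtain c d where cd: "(c, d) \<in> near_differences e v"
          "energy_one m E c + energy_one m E d < ereal (q + r)"
          using difference_energy_lessE[of e v "ereal (q + r)"] r q by auto
        have "difference_energy e ?w \<le> difference_energy e ?w + ereal
            (t * (1 - t) * ((L2_norm m (\<lambda>x. a x - c x))\<^sup>2 + (L2_norm m (\<lambda>x. b x - d x))\<^sup>2))"
          using t by (intro ereal_le_add_self) simp
        also have "\<dots> \<le> ereal t * (energy_one m E a + energy_one m E b)
            + ereal (1 - t) * (energy_one m E c + energy_one m E d)"
          by (rule difference_energy_strongly_convex[OF ab(1) cd(1) u v t])
        also have "\<dots> \<le> ereal t * ereal (p + r) + ereal (1 - t) * ereal (q + r)"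
          using ab(2) cd(2) t by (intro add_mono ereal_mult_left_mono) auto
        also have "\<dots> = ereal t * difference_energy e u + ereal (1 - t) * difference_energy e v + ereal r"
          by (simp add: p q algebra_simps)
        finally show "difference_energy e ?w
          \<le> ereal t * difference_energy e u + ereal (1 - t) * difference_energy e v + ereal r" .
      qed
    qed
    also have "\<dots> \<le> ereal t * difference_relaxation u + ereal (1 - t) * difference_relaxation v"
      using t by (intro add_mono ereal_mult_left_mono difference_energy_le_relaxation e) auto
    finally show ?thesis .
  qed
  then show "difference_relaxation ?w
    \<le> ereal t * difference_relaxation u + ereal (1 - t) * difference_relaxation v"
    unfolding difference_relaxation_def[of ?w] by (intro SUP_least) simp
qed

lemma difference_relaxation_lsc: "L2_lsc m difference_relaxation"
  unfolding L2_lsc_def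
proof (intro ballI allI impI)
  fix u c assume u: "u \<in> L2 m" and "c < difference_relaxation u"
  then obtain e where e: "e > 0" "c < difference_energy e u"
    unfolding difference_relaxation_def less_SUP_iff by auto
  show "\<exists>\<delta>>0. \<forall>v\<in>L2 m. L2_norm m (\<lambda>x. v x - u x) < \<delta> \<longrightarrow> c < difference_relaxation v"
  proof (intro exI[of _ "e/2"] conjI ballI impI)
    fix v assume v: "v \<in> L2 m" "L2_norm m (\<lambda>x. v x - u x) < e/2"
    \<comment> \<open>The \<open>e/2\<close>-ball around \<open>v\<close> lies in the
      \<open>e\<close>-ball around \<open>u\<close>, and an infimum over fewer pairs is
      larger.\<close>
    have "difference_energy e u \<le> difference_energy (e/2) v"
      using near_differences_shift[OF u v, of "e/2"] by (intro difference_energy_mono) simp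
    also have "\<dots> \<le> difference_relaxation v"
      using e by (intro difference_energy_le_relaxation) simp
    finally show "c < difference_relaxation v" using e(2) by simp
  qed (use e in simp)
qed

lemma difference_relaxation_le:
  assumes "a \<in> L2 m" "b \<in> L2 m"
  shows "difference_relaxation (\<lambda>x. a x - b x) \<le> energy_one m E a + energy_one m E b"
  unfolding difference_relaxation_def
  by (rule SUP_least, rule difference_energy_le) (simp add: near_differences_def assms)

lemma difference_relaxation_nonneg: "0 \<le> difference_relaxation w"
  using difference_energy_nonneg[of 1 w] difference_energy_le_relaxation[of 1 w] by simp

text \<open>The relaxation is itself an admissible competitor: since \<open>energy_one\<close>
  vanishes at 0, the pairs \<open>(w, 0)\<close> and \<open>(0, -w)\<close> give the two required
  upper bounds.\<close>

lemma difference_relaxation_le_sym_closure: "difference_relaxation w \<le> sym_closure m E w"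
  unfolding sym_closure_def
proof (rule Sup_upper, intro CollectI exI[of _ difference_relaxation] conjI ballI
    difference_relaxation_convex difference_relaxation_lsc refl)
  fix w assume w: "w \<in> L2 m"
  show "- \<infinity> < difference_relaxation w"
    by (rule less_le_trans[OF _ difference_relaxation_nonneg]) simp
  show "difference_relaxation w \<le> energy_one m E w"
    using difference_relaxation_le[OF w L2_zero] by (simp add: energy_one_zero)
  show "difference_relaxation w \<le> energy_one m E (\<lambda>x. - w x)"
    using difference_relaxation_le[OF L2_zero L2_uminus[OF w]] by (simp add: energy_one_zero)
qed

text \<open>As the tolerance \<open>(1/2)^n\<close> shrinks, the infima \<open>p n\<close> increase
  to a finite limit. A later pair is also admissible for an earlier tolerance, so its midpoint with
  the earlier pair has energy at least \<open>p n\<close>; strong convexity turns this into a bound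
  on the distance of the two pairs.\<close>

lemma minimising_sequence:
  assumes w: "w \<in> L2 m" and fin: "difference_relaxation w < \<infinity>"
  obtains a b :: "nat \<Rightarrow> 'a \<Rightarrow> real" and C :: real and \<delta> :: "nat \<Rightarrow> real"
  where "\<And>n. (a n, b n) \<in> near_differences ((1/2)^n) w"
    and "\<And>n. energy_one m E (a n) + energy_one m E (b n) \<le> ereal C"
    and "\<And>n k. n \<le> k \<Longrightarrow>
      (L2_norm m (\<lambda>x. a n x - a k x))\<^sup>2 + (L2_norm m (\<lambda>x. b n x - b k x))\<^sup>2 \<le> \<delta> n"
    and "\<delta> \<longlonglongrightarrow> 0"
proof -
  obtain R where R: "difference_relaxation w = ereal R"
    using fin difference_relaxation_nonneg[of w] by (cases "difference_relaxation w") auto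
  define p where "p n = real_of_ereal (difference_energy ((1/2)^n) w)" for n :: nat
  have p: "difference_energy ((1/2)^n) w = ereal (p n)" and pR: "p n \<le> R" for n
  proof -
    have "difference_energy ((1/2)^n) w \<le> ereal R"
      unfolding R[symmetric] by (rule difference_energy_le_relaxation) simp
    then show "difference_energy ((1/2)^n) w = ereal (p n)" "p n \<le> R"
      using difference_energy_nonneg[of "(1/2)^n" w]
      by (cases "difference_energy ((1/2)^n) w"; auto simp: p_def)+
  qed
  have "incseq p"
  proof (rule incseq_SucI)
    fix n
    have "difference_energy ((1/2)^n) w \<le> difference_energy ((1/2)^Suc n) w"
      by (intro difference_energy_mono near_differences_mono) simp
    then show "p n \<le> p (Suc n)" by (simp add: p del: power_Suc)
  qed
  then obtain L where L: "p \<longlonglongrightarrow> L" and pL: "\<And>n. p n \<le> L"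
    using incseq_convergent[of p R] pR by metis
  have "\<exists>a b. (a, b) \<in> near_differences ((1/2)^n) w \<and>
      energy_one m E a + energy_one m E b < ereal (p n + (1/2)^n)" for n
    using difference_energy_lessE[of "(1/2)^n" w "ereal (p n + (1/2)^n)"] by (simp add: p) metis
  then obtain a b where near: "\<And>n. (a n, b n) \<in> near_differences ((1/2)^n) w"
    and less: "\<And>n. energy_one m E (a n) + energy_one m E (b n) < ereal (p n + (1/2)^n)"
    by metis
  \<comment> \<open>The midpoint estimate bounds a quarter of the squared distance by
    \<open>(p k - p n)/2\<close> plus half of both slacks. Multiplying by 4 and using
    \<open>p k \<le> L\<close> and \<open>(1/2)^k \<le> (1/2)^n\<close> gives this value.\<close>
  define \<delta> where "\<delta> n = 2 * (L - p n) + 4 * (1/2)^n" for n :: nat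
  show ?thesis
  proof (rule that[of a b "R + 1" \<delta>])
    show "(a n, b n) \<in> near_differences ((1/2)^n) w" for n by (rule near)
    have "p n + (1/2)^n \<le> R + 1" for n
      using pR[of n] by (intro add_mono) (simp_all add: power_le_one)
    then show "energy_one m E (a n) + energy_one m E (b n) \<le> ereal (R + 1)" for n
      by (intro order_trans[OF less_imp_le[OF less]]) simp
    show "\<delta> \<longlonglongrightarrow> 0"
    proof -
      have "\<delta> \<longlonglongrightarrow> 2 * (L - L) + 4 * 0"
        unfolding \<delta>_def by (intro tendsto_intros L LIMSEQ_power_zero) simp
      then show ?thesis by simp
    qed
    fix n k :: nat assume nk: "n \<le> k"
    define N where "N = (L2_norm m (\<lambda>x. a n x - a k x))\<^sup>2 + (L2_norm m (\<lambda>x. b n x - b k x))\<^sup>2"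
    have pow: "(1/2::real)^k \<le> (1/2)^n" using nk by (intro power_decreasing) auto
    have near': "(a k, b k) \<in> near_differences ((1/2)^n) w"
      using near[of k] near_differences_mono[OF pow] by blast
    have "ereal (p n + 1/4 * N) = difference_energy ((1/2)^n) w + ereal (1/2 * (1 - 1/2) * N)"
      by (simp add: p)
    \<comment> \<open>Writing \<open>w\<close> as its own midpoint fits the shape of
      \<open>difference_energy_strongly_convex\<close>.\<close>
    also have "difference_energy ((1/2)^n) w = difference_energy ((1/2)^n) (\<lambda>x. 1/2 * w x + (1 - 1/2) * w x)"
      by simp
    also have "\<dots> + ereal (1/2 * (1 - 1/2) * N)
      \<le> ereal (1/2) * (energy_one m E (a n) + energy_one m E (b n))
        + ereal (1 - 1/2) * (energy_one m E (a k) + energy_one m E (b k))"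
      unfolding N_def by (rule difference_energy_strongly_convex[OF near near' w w]) simp_all
    also have "\<dots> \<le> ereal (1/2) * ereal (p n + (1/2)^n) + ereal (1 - 1/2) * ereal (p k + (1/2)^k)"
      by (intro add_mono ereal_mult_left_mono less_imp_le[OF less]) simp_all
    also have "\<dots> = ereal (1/2 * (p n + (1/2)^n) + 1/2 * (p k + (1/2)^k))" by simp
    finally have "p n + 1/4 * N \<le> 1/2 * (p n + (1/2)^n) + 1/2 * (p k + (1/2)^k)"
      by (simp only: ereal_less_eq)
    then have "N \<le> \<delta> n" using pL[of k] pow unfolding \<delta>_def by argo
    then show "(L2_norm m (\<lambda>x. a n x - a k x))\<^sup>2 + (L2_norm m (\<lambda>x. b n x - b k x))\<^sup>2 \<le> \<delta> n"
      by (simp add: N_def)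
  qed
qed

text \<open>Both components of a minimising sequence converge, lower semicontinuity keeps the
  energies of the limits finite, and the tolerance tends to 0, so the limits differ by
  \<open>w\<close> almost everywhere.\<close>

lemma difference_representation:
  assumes w: "w \<in> L2 m" and fin: "difference_relaxation w < \<infinity>"
  obtains a b where "a \<in> effective_domain m E" "b \<in> effective_domain m E" "w = (\<lambda>x. a x - b x)"
proof (rule minimising_sequence[OF assms])
  fix a b :: "nat \<Rightarrow> 'a \<Rightarrow> real" and C :: real and \<delta> :: "nat \<Rightarrow> real"
  assume near: "\<And>n. (a n, b n) \<in> near_differences ((1/2)^n) w"
    and C: "\<And>n. energy_one m E (a n) + energy_one m E (b n) \<le> ereal C"
    and dist: "\<And>n k. n \<le> k \<Longrightarrow>
      (L2_norm m (\<lambda>x. a n x - a k x))\<^sup>2 + (L2_norm m (\<lambda>x. b n x - b k x))\<^sup>2 \<le> \<delta> n"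
    and \<delta>: "\<delta> \<longlonglongrightarrow> 0"
  have aL: "a n \<in> L2 m" and bL: "b n \<in> L2 m"
    and close: "L2_norm m (\<lambda>x. a n x - b n x - w x) < (1/2)^n" for n
    using near[of n] by (auto simp: near_differences_def)
  have da: "(L2_norm m (\<lambda>x. a n x - a k x))\<^sup>2 \<le> \<delta> n"
    and db: "(L2_norm m (\<lambda>x. b n x - b k x))\<^sup>2 \<le> \<delta> n" if "n \<le> k" for n k
    using dist[OF that] zero_le_power2[of "L2_norm m (\<lambda>x. a n x - a k x)"]
      zero_le_power2[of "L2_norm m (\<lambda>x. b n x - b k x)"] by linarith+
  obtain a' where a': "a' \<in> L2 m" "(\<lambda>n. L2_norm m (\<lambda>x. a' x - a n x)) \<longlonglongrightarrow> 0"
    using L2_complete_power2[OF aL \<delta> da] .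
  obtain b' where b': "b' \<in> L2 m" "(\<lambda>n. L2_norm m (\<lambda>x. b' x - b n x)) \<longlonglongrightarrow> 0"
    using L2_complete_power2[OF bL \<delta> db] .
  have "E (a n) \<le> ereal C" and "E (b n) \<le> ereal C" for n
  proof -
    have "energy_one m E (a n) \<le> ereal C" "energy_one m E (b n) \<le> ereal C"
      using order_trans[OF ereal_le_add_self[OF energy_one_nonneg[OF bL]] C]
        order_trans[OF ereal_le_add_self2[OF energy_one_nonneg[OF aL]] C] by blast+
    then show "E (a n) \<le> ereal C" "E (b n) \<le> ereal C"
      using energy_le_energy_one order_trans by blast+
  qed
  then have "E a' \<le> ereal C" "E b' \<le> ereal C"
    using L2_lsc_limit_le[OF lsc a'(1) aL a'(2)] L2_lsc_limit_le[OF lsc b'(1) bL b'(2)] by blast+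
  then have fin': "E a' < \<infinity>" "E b' < \<infinity>" by auto
  have "L2_norm m (\<lambda>x. a' x - b' x - w x)
    \<le> L2_norm m (\<lambda>x. a' x - a n x) + (1/2)^n + L2_norm m (\<lambda>x. b' x - b n x)" for n
  proof -
    have "(\<lambda>x. a' x - b' x - w x) = (\<lambda>x. (a' x - a n x) + (a n x - b n x - w x) + (b n x - b' x))"
      by (simp add: fun_eq_iff)
    then have "L2_norm m (\<lambda>x. a' x - b' x - w x)
      \<le> L2_norm m (\<lambda>x. (a' x - a n x) + (a n x - b n x - w x)) + L2_norm m (\<lambda>x. b n x - b' x)"
      using L2_norm_triangle[OF L2_add[OF L2_diff[OF a'(1) aL] L2_diff[OF L2_diff[OF aL bL] w]]
          L2_diff[OF bL b'(1)], of n n n n] by (simp only:)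
    also have "L2_norm m (\<lambda>x. (a' x - a n x) + (a n x - b n x - w x))
      \<le> L2_norm m (\<lambda>x. a' x - a n x) + L2_norm m (\<lambda>x. a n x - b n x - w x)"
      by (intro L2_norm_triangle L2_diff aL bL a' w)
    finally show ?thesis
      using close[of n] L2_norm_minus_commute[of m "b n" b'] by simp
  qed
  moreover have "(\<lambda>n. L2_norm m (\<lambda>x. a' x - a n x) + (1/2)^n + L2_norm m (\<lambda>x. b' x - b n x))
      \<longlonglongrightarrow> 0 + 0 + 0"
    by (intro tendsto_add a' b' LIMSEQ_power_zero) simp
  ultimately have "L2_norm m (\<lambda>x. a' x - b' x - w x) \<le> 0"
    by (intro LIMSEQ_le_const[where a = "L2_norm m (\<lambda>x. a' x - b' x - w x)"]) auto
  then have "AE x in m. a' x - b' x - w x = 0"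
    by (intro L2_norm_eq_zero_AE L2_diff a' b' w antisym) simp_all
  \<comment> \<open>The seminorm sees functions only up to null sets. Replacing \<open>a'\<close> by
    \<open>w + b'\<close> makes the representation exact everywhere without changing the
    energy.\<close>
  then have "AE x in m. a' x = w x + b' x" by eventually_elim simp
  then have "E (\<lambda>x. w x + b' x) = E a'"
    by (intro L2_lsc_AE_cong[OF lsc, symmetric] L2_add a' b' w)
  then show thesis
    using fin' a' b' w by (intro that[of "\<lambda>x. w x + b' x" b']) (auto simp: effective_domain_def L2_add)
qed

section \<open>The Dirichlet space as the set of scaled differences of domain elements\<close>

lemma dirichlet_spaceE:
  assumes "f \<in> dirichlet_space m E"
  obtains r a b where "r > 0" "a \<in> effective_domain m E" "b \<in> effective_domain m E"
    "f = (\<lambda>x. r * (a x - b x))"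
proof -
  obtain r where f: "f \<in> L2 m" and r: "r > 0" "sym_closure m E (\<lambda>x. r * f x) < \<infinity>"
    using assms by (auto simp: dirichlet_space_def)
  obtain a b where ab: "a \<in> effective_domain m E" "b \<in> effective_domain m E"
    "(\<lambda>x. r * f x) = (\<lambda>x. a x - b x)"
    using difference_representation[OF L2_scale[OF f] le_less_trans[OF difference_relaxation_le_sym_closure r(2)]] .
  have "f = (\<lambda>x. 1/r * (a x - b x))"
    using r(1) unfolding ab(3)[THEN fun_cong, symmetric] by simp
  then show ?thesis
    using r(1) ab by (intro that[of "1/r" a b]) simp_all
qed

text \<open>After division by \<open>2*r\<close> the function is the midpoint of \<open>a\<close>
  and \<open>-b\<close>. Every competitor is at most \<open>energy_one m E a\<close> at
  \<open>a\<close> and, by the reflected constraint, at most \<open>energy_one m E b\<close> at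
  \<open>-b\<close>, so convexity bounds all competitors at once.\<close>

lemma dirichlet_spaceI:
  assumes r: "r > 0" and a: "a \<in> effective_domain m E" and b: "b \<in> effective_domain m E"
  shows "(\<lambda>x. r * (a x - b x)) \<in> dirichlet_space m E"
proof -
  define f where "f = (\<lambda>x. r * (a x - b x))"
  have aL: "a \<in> L2 m" and bL: "b \<in> L2 m" using a b by (auto simp: effective_domain_def)
  have scaled: "(\<lambda>x. 1/(2*r) * f x) = (\<lambda>x. 1/2 * a x + (1 - 1/2) * (- b x))"
    using r by (auto simp: f_def field_simps)
  have "sym_closure m E (\<lambda>x. 1/(2*r) * f x)
    \<le> ereal (1/2) * energy_one m E a + ereal (1 - 1/2) * energy_one m E b"
    unfolding sym_closure_def scaled
  proof (rule Sup_least, clarify)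
    fix F assume F: "L2_convex m F"
      "\<forall>w\<in>L2 m. F w \<le> energy_one m E w \<and> F w \<le> energy_one m E (\<lambda>x. - w x)"
    have "F (\<lambda>x. 1/2 * a x + (1 - 1/2) * (- b x))
      \<le> ereal (1/2) * F a + ereal (1 - 1/2) * F (\<lambda>x. - b x)"
      by (rule F(1)[unfolded L2_convex_def, rule_format, OF aL L2_uminus[OF bL]]) simp
    also have "\<dots> \<le> ereal (1/2) * energy_one m E a + ereal (1 - 1/2) * energy_one m E b"
      using F(2) aL L2_uminus[OF bL] by (intro add_mono ereal_mult_left_mono) auto
    finally show "F (\<lambda>x. 1/2 * a x + (1 - 1/2) * (- b x))
      \<le> ereal (1/2) * energy_one m E a + ereal (1 - 1/2) * energy_one m E b" .
  qed
  also have "\<dots> < \<infinity>"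
    using energy_one_finite[OF a] energy_one_finite[OF b] energy_one_nonneg[OF aL] energy_one_nonneg[OF bL]
    by (cases "energy_one m E a"; cases "energy_one m E b") auto
  finally have "sym_closure m E (\<lambda>x. 1/(2*r) * f x) < \<infinity>" .
  moreover have "f \<in> L2 m" unfolding f_def by (intro L2_scale L2_diff aL bL)
  ultimately have "f \<in> dirichlet_space m E"
    using r unfolding dirichlet_space_def by (intro CollectI conjI exI[of _ "1/(2*r)"]) simp_all
  then show ?thesis by (simp only: f_def)
qed

section \<open>Linear and lattice structure of the Dirichlet space\<close>

lemma dirichlet_space_subset_L2: "dirichlet_space m E \<subseteq> L2 m"
  by (auto simp: dirichlet_space_def)

lemma dirichlet_space_zero: "(\<lambda>x. 0) \<in> dirichlet_space m E"
  using dirichlet_spaceI[OF zero_less_one zero_effective_domain zero_effective_domain] by simp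

lemma dirichlet_space_add:
  assumes "u \<in> dirichlet_space m E" "v \<in> dirichlet_space m E"
  shows "(\<lambda>x. u x + v x) \<in> dirichlet_space m E"
proof -
  obtain r a b where r: "r > 0" "a \<in> effective_domain m E" "b \<in> effective_domain m E"
    "u = (\<lambda>x. r * (a x - b x))" using assms(1) by (rule dirichlet_spaceE)
  obtain s c d where s: "s > 0" "c \<in> effective_domain m E" "d \<in> effective_domain m E"
    "v = (\<lambda>x. s * (c x - d x))" using assms(2) by (rule dirichlet_spaceE)
  \<comment> \<open>The effective domain is known to be convex, not closed under sums. These weights
    pull out the common factor \<open>r + s\<close> and leave convex combinations.\<close>
  define t where "t = r / (r + s)"
  have t: "0 < t" "t < 1" using r s by (auto simp: t_def)
  have rs: "r = (r + s) * t" "s = (r + s) * (1 - t)" using r s by (simp_all add: t_def field_simps)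
  have "u x + v x = (r + s) * ((t * a x + (1 - t) * c x) - (t * b x + (1 - t) * d x))" for x
  proof -
    have "u x + v x = ((r + s) * t) * (a x - b x) + ((r + s) * (1 - t)) * (c x - d x)"
      unfolding rs[symmetric] by (simp add: r s)
    then show ?thesis by (simp add: algebra_simps)
  qed
  moreover have "(\<lambda>x. (r + s) * ((t * a x + (1 - t) * c x) - (t * b x + (1 - t) * d x))) \<in> dirichlet_space m E"
    using r s t by (intro dirichlet_spaceI effective_domain_convex) simp_all
  ultimately show ?thesis by simp
qed

lemma dirichlet_space_scale:
  assumes "u \<in> dirichlet_space m E"
  shows "(\<lambda>x. c * u x) \<in> dirichlet_space m E"
proof -
  obtain r a b where r: "r > 0" "a \<in> effective_domain m E" "b \<in> effective_domain m E"
    "u = (\<lambda>x. r * (a x - b x))" using assms by (rule dirichlet_spaceE)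
  consider "c > 0" | "c < 0" | "c = 0" by linarith
  then show ?thesis
  proof cases
    case 1
    then show ?thesis
      using dirichlet_spaceI[of "c * r" a b] r by (simp add: mult.assoc)
  next
    case 2
    \<comment> \<open>The effective domain need not be symmetric, so the sign is absorbed by
      exchanging the two functions.\<close>
    have "c * u x = (- c * r) * (b x - a x)" for x
      unfolding r(4) by (simp add: algebra_simps)
    with 2 show ?thesis
      using dirichlet_spaceI[of "- c * r" b a] r by (simp add: mult_neg_pos)
  next
    case 3
    then show ?thesis by (simp add: dirichlet_space_zero)
  qed
qed

lemma dirichlet_space_linear: "L2_linear_subspace m (dirichlet_space m E)"
  unfolding L2_linear_subspace_def
  by (simp add: dirichlet_space_subset_L2 dirichlet_space_zero dirichlet_space_add dirichlet_space_scale)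

lemma dirichlet_space_pos_part:
  assumes dom_min: "\<And>a b. a \<in> effective_domain m E \<Longrightarrow> b \<in> effective_domain m E \<Longrightarrow>
      (\<lambda>x. min (a x) (b x)) \<in> effective_domain m E"
    and u: "u \<in> dirichlet_space m E"
  shows "(\<lambda>x. max (u x) 0) \<in> dirichlet_space m E"
proof -
  obtain r a b where r: "r > 0" "a \<in> effective_domain m E" "b \<in> effective_domain m E"
    "u = (\<lambda>x. r * (a x - b x))" using u by (rule dirichlet_spaceE)
  have "max (u x) 0 = r * (a x - min (a x) (b x))" for x
  proof -
    have "max (u x) 0 = r * max (a x - b x) 0"
      using r(1) max_mult_distrib_left[of r "a x - b x" 0] by (simp add: r(4))
    also have "max (a x - b x) 0 = a x - min (a x) (b x)" by linarith
    finally show ?thesis .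
  qed
  then show ?thesis
    using dirichlet_spaceI[OF r(1,2) dom_min[OF r(2,3)]] by simp
qed

lemma dirichlet_space_riesz:
  assumes dom_min: "\<And>a b. a \<in> effective_domain m E \<Longrightarrow> b \<in> effective_domain m E \<Longrightarrow>
      (\<lambda>x. min (a x) (b x)) \<in> effective_domain m E"
  shows "L2_riesz_subspace m (dirichlet_space m E)"
  unfolding L2_riesz_subspace_def
proof (intro conjI ballI dirichlet_space_linear)
  fix u v assume u: "u \<in> dirichlet_space m E" and v: "v \<in> dirichlet_space m E"
  \<comment> \<open>Both lattice operations reduce to the positive part of \<open>u - v\<close>:
    subtracting it from \<open>u\<close> gives the minimum, adding it to \<open>v\<close> the
    maximum.\<close>
  define w where "w = (\<lambda>x. max (u x + (-1) * v x) 0)"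
  have w: "w \<in> dirichlet_space m E"
    unfolding w_def by (rule dirichlet_space_pos_part[OF dom_min dirichlet_space_add[OF u dirichlet_space_scale[OF v]]])
  have "(\<lambda>x. min (u x) (v x)) = (\<lambda>x. u x + (-1) * w x)" "(\<lambda>x. max (u x) (v x)) = (\<lambda>x. v x + w x)"
    by (auto simp: w_def)
  then show "(\<lambda>x. min (u x) (v x)) \<in> dirichlet_space m E" "(\<lambda>x. max (u x) (v x)) \<in> dirichlet_space m E"
    using dirichlet_space_add[OF u dirichlet_space_scale[OF w, of "-1"]] dirichlet_space_add[OF v w]
    by simp_all
qed

end

section \<open>Application to Dirichlet forms\<close>

theorem theorem4p7:
  fixes X :: "'a topology" and m :: "'a measure"
    and E :: "('a \<Rightarrow> real) \<Rightarrow> ereal"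
  assumes "borel_measure_on X m"
    and "countably_generated m"
    and "sigma_finite_measure m"
    and "measure_support X m = topspace X"
    and "dirichlet_form m E"
    and "E (\<lambda>x. 0) = 0"
  shows "L2_riesz_subspace m (dirichlet_space m E)"
proof -
  note E = assms(5)[unfolded dirichlet_form_def]
  interpret L2_energy m E
    by unfold_locales (use E assms(6) in auto)
  show ?thesis
  proof (rule dirichlet_space_riesz)
    fix a b assume a: "a \<in> effective_domain m E" and b: "b \<in> effective_domain m E"
    then have aL: "a \<in> L2 m" and bL: "b \<in> L2 m" and fin: "E a < \<infinity>" "E b < \<infinity>"
      by (auto simp: effective_domain_def)
    \<comment> \<open>The energy of the maximum is nonnegative, so adding it brings the lattice
      inequality of the Dirichlet form into play.\<close>
    have "E (\<lambda>x. min (a x) (b x)) \<le> E (\<lambda>x. min (a x) (b x)) + E (\<lambda>x. max (a x) (b x))"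
      by (intro ereal_le_add_self nonneg L2_max aL bL)
    also have "\<dots> \<le> E a + E b" using E aL bL by blast
    also have "\<dots> < \<infinity>" using fin by simp
    finally show "(\<lambda>x. min (a x) (b x)) \<in> effective_domain m E"
      by (simp add: effective_domain_def L2_min aL bL)
  qed
qed

end
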